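(* Let $\sigma>0$ and $s>0$. Let $\mu_{\mathrm{GS}}=\mathcal N(0,\sigma^2)\boxplus \mathrm{SC}(s\sigma^2)$, and for each positive integer $k$ let $m_k=\int_{\mathbb R}x^k\,d\mu_{\mathrm{GS}}(x)$ be the $k$-th moment of $\mu_{\mathrm{GS}}$. Then $$m_k=\begin{cases}0 & \text{if } k=2r+1 \text{ is odd},\\[2pt] \sigma^{2r}\displaystyle\sum_{\pi\in\mathcal P_2(2r)}(s+1)^{\#\mathrm{chord}_{\mathrm{iso}}(\pi)} & \text{if } k=2r \text{ is even.}\end{cases}$$
   Context: $\mathcal N(0,\sigma^2)$ is the centered Gaussian law with variance $\sigma^2$. For $v>0$, $\mathrm{SC}(v)$ is the semicircle law with variance $v$, with density $\frac{1}{2\pi v}\sqrt{4v-x^2}$ on $[-2\sqrt v,2\sqrt v]$. The symbol $\boxplus$ denotes the (additive) free convolution of probability measures on $\mathbb R$: $\mu\boxplus\nu$ is the distribution of $X+Y$ where $X,Y$ are freely independent self-adjoint noncommutative random variables with distributions $\mu,\nu$. For measures with all moments finite, the free cumulants $\kappa_n$ (defined recursively from the moments by $m_n=\sum_{\pi\in\mathcal{NC}(n)}\prod_{B\in\pi}\kappa_{|B|}$, the sum over non-crossing partitions of $\{1,\dots,n\}$) are additive under $\boxplus$. $\mathcal P_2(2r)$ is the set of all pairing partitions of $\{1,\dots,2r\}$ (partitions all of whose blocks have exactly two elements; the blocks are called chords). Two chords of $\pi$ cross if they can be written as $\{a_1,b_1\},\{a_2,b_2\}$ with $a_1<a_2<b_1<b_2$.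 A chord of $\pi$ is isolated if it crosses no other chord of $\pi$; $\mathrm{chord}_{\mathrm{iso}}(\pi)$ is the set of isolated chords of $\pi$, and $\#$ denotes cardinality. *)

theory Defs
  imports "HOL-Probability.Probability"
begin

section \<open>Noncommutative probability\<close>

text \<open>
  A unital complex \<open>*\<close>-algebra. The distribution has no type class of complex algebras, so the
  complex scalar multiplication is a parameter; the algebra is the whole type.
\<close>

locale star_algebra = vector_space smul
  for smul :: "complex \<Rightarrow> 'a::ring_1 \<Rightarrow> 'a" +
  fixes star :: "'a \<Rightarrow> 'a"
  assumes mult_scale_left: "smul c a * b = smul c (a * b)"
    and mult_scale_right: "a * smul c b = smul c (a * b)"
    and star_star: "star (star a) = a"
    and star_add: "star (a + b) = star a + star b"
    and star_scale: "star (smul c a) = smul (cnj c) (star a)"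
    and star_mult: "star (a * b) = star b * star a"

text \<open>
  A \<open>*\<close>-probability space: a unital \<open>*\<close>-algebra with a state \<open>\<phi>\<close>. Boundedness is not required,
  so elements may have laws that are not compactly supported.
\<close>

locale star_prob_space = star_algebra smul star
  for smul :: "complex \<Rightarrow> 'a::ring_1 \<Rightarrow> 'a" and star :: "'a \<Rightarrow> 'a" +
  fixes \<phi> :: "'a \<Rightarrow> complex"
  assumes state_add: "\<phi> (a + b) = \<phi> a + \<phi> b"
    and state_scale: "\<phi> (smul c a) = c * \<phi> a"
    and state_one: "\<phi> 1 = 1"
    and state_pos: "\<phi> (star a * a) \<in> \<real>\<^sub>\<ge>\<^sub>0"

inductive_set generated_algebra :: "(complex \<Rightarrow> 'a::ring_1 \<Rightarrow> 'a) \<Rightarrow> 'a set \<Rightarrow> 'a set"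
  for smul :: "complex \<Rightarrow> 'a \<Rightarrow> 'a" and S :: "'a set" where
  one: "1 \<in> generated_algebra smul S"
| base: "a \<in> S \<Longrightarrow> a \<in> generated_algebra smul S"
| smul: "a \<in> generated_algebra smul S \<Longrightarrow> smul c a \<in> generated_algebra smul S"
| add: "a \<in> generated_algebra smul S \<Longrightarrow> b \<in> generated_algebra smul S
    \<Longrightarrow> a + b \<in> generated_algebra smul S"
| mult: "a \<in> generated_algebra smul S \<Longrightarrow> b \<in> generated_algebra smul S
    \<Longrightarrow> a * b \<in> generated_algebra smul S"

text \<open>
  Free independence of a family of subalgebras: \<open>\<phi>\<close> vanishes on every nonempty product
  \<open>a\<^sub>1 \<cdots> a\<^sub>n\<close> of centered elements, \<open>a\<^sub>j\<close> being taken from the algebra with index \<open>i\<^sub>j\<close>,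
  in which neighbouring indices are distinct.
\<close>

definition free_subalgebras :: "('a::ring_1 \<Rightarrow> complex) \<Rightarrow> 'i set \<Rightarrow> ('i \<Rightarrow> 'a set) \<Rightarrow> bool" where
  "free_subalgebras \<phi> I A \<longleftrightarrow>
     (\<forall>is as. as \<noteq> [] \<and> length is = length as \<and> set is \<subseteq> I
        \<and> (\<forall>j. Suc j < length is \<longrightarrow> is ! j \<noteq> is ! Suc j)
        \<and> (\<forall>j<length as. as ! j \<in> A (is ! j) \<and> \<phi> (as ! j) = 0)
        \<longrightarrow> \<phi> (prod_list as) = 0)"

definition freely_independent ::
    "(complex \<Rightarrow> 'a::ring_1 \<Rightarrow> 'a) \<Rightarrow> ('a \<Rightarrow> complex) \<Rightarrow> 'a \<Rightarrow> 'a \<Rightarrow> bool" where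
  "freely_independent smul \<phi> X Y \<longleftrightarrow>
     free_subalgebras \<phi> (UNIV :: bool set) (\<lambda>i. generated_algebra smul {if i then X else Y})"

text \<open>
  The self-adjoint random variable \<open>X\<close> has distribution \<open>\<mu>\<close>. As usual in a \<open>*\<close>-probability space,
  the distribution is given by the moments; \<open>\<mu>\<close> is a Borel probability measure with all moments
  finite.
\<close>

definition has_distribution ::
    "('a::ring_1 \<Rightarrow> 'a) \<Rightarrow> ('a \<Rightarrow> complex) \<Rightarrow> 'a \<Rightarrow> real measure \<Rightarrow> bool" where
  "has_distribution star \<phi> X \<mu> \<longleftrightarrow>
     star X = X \<and> real_distribution \<mu> \<and>
     (\<forall>n::nat. integrable \<mu> (\<lambda>x. x ^ n) \<and> \<phi> (X ^ n) = complex_of_real (\<integral>x. x ^ n \<partial>\<mu>))"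

text \<open>
  \<open>\<rho>\<close> is the free convolution of \<open>\<mu>\<close> and \<open>\<nu>\<close>: the distribution of \<open>X + Y\<close> for free self-adjoint
  \<open>X\<close>, \<open>Y\<close> with distributions \<open>\<mu>\<close>, \<open>\<nu>\<close>. This is a relation because, for laws with all moments
  finite, \<open>\<rho>\<close> is determined by \<open>\<mu>\<close> and \<open>\<nu>\<close> only up to its moments; it is unique as soon as
  it is moment-determinate, e.g. if \<open>\<mu>\<close> is normal and \<open>\<nu>\<close> is a semicircle law. The type argument
  carries the \<open>*\<close>-algebra, since HOL cannot quantify existentially over types.
\<close>

definition is_free_convolution ::
    "'a::ring_1 itself \<Rightarrow> real measure \<Rightarrow> real measure \<Rightarrow> real measure \<Rightarrow> bool" where
  "is_free_convolution _ \<mu> \<nu> \<rho> \<longleftrightarrow>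
     (\<exists>(smul :: complex \<Rightarrow> 'a \<Rightarrow> 'a) star \<phi> X Y.
        star_prob_space smul star \<phi> \<and> freely_independent smul \<phi> X Y \<and>
        has_distribution star \<phi> X \<mu> \<and> has_distribution star \<phi> Y \<nu> \<and>
        has_distribution star \<phi> (X + Y) \<rho>)"

definition semicircle_density :: "real \<Rightarrow> real \<Rightarrow> real" where
  "semicircle_density v x =
     (if x \<in> {- 2 * sqrt v..2 * sqrt v} then sqrt (4 * v - x\<^sup>2) / (2 * pi * v) else 0)"

section \<open>Pairings\<close>

definition pairings :: "nat \<Rightarrow> nat set set set" where
  "pairings n = {P. partition_on {1..n} P \<and> (\<forall>B\<in>P. card B = 2)}"

definition chords_cross :: "nat set \<Rightarrow> nat set \<Rightarrow> bool" where
  "chords_cross C D \<longleftrightarrow>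
     (\<exists>a\<^sub>1 b\<^sub>1 a\<^sub>2 b\<^sub>2. {C, D} = {{a\<^sub>1, b\<^sub>1}, {a\<^sub>2, b\<^sub>2}} \<and> a\<^sub>1 < a\<^sub>2 \<and> a\<^sub>2 < b\<^sub>1 \<and> b\<^sub>1 < b\<^sub>2)"

definition isolated_chords :: "nat set set \<Rightarrow> nat set set" where
  "isolated_chords P = {C \<in> P. \<forall>D\<in>P. D \<noteq> C \<longrightarrow> \<not> chords_cross C D}"

end

theory Submission
  imports Defs
begin

text \<open>Let \<open>v = s \<sigma>\<^sup>2\<close>. Conditioning \<open>(X + Y) ^ k\<close> on the Gaussian variable \<open>X\<close> gives polynomials \<open>E\<^sub>k\<close> in \<open>X\<close> with
  \<open>E\<^sub>0 = 1\<close> and \<open>E\<^sub>k\<^sub>+\<^sub>1 = X E\<^sub>k + v (\<Sum>i<k. \<phi>(E\<^sub>i) E\<^sub>k\<^sub>-\<^sub>1\<^sub>-\<^sub>i)\<close>, because a semicircular \<open>Y\<close> free from \<open>X\<close> is an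
  operator-valued semicircular element with covariance \<open>a \<mapsto> v \<phi>(a)\<close>. Hence \<open>F n k = \<phi>(X\<^sup>n E\<^sub>k)\<close> satisfies
  \<open>F n (k + 1) = F (n + 1) k + v (\<Sum>i<k. F 0 i * F n (k - 1 - i))\<close>, and \<open>F n 0\<close> is \<open>\<sigma>\<^sup>n\<close> times the number of
  pairings of \<open>n\<close> points. Counting the pairings of \<open>n + k\<close> points with weight \<open>s + 1\<close> for every isolated
  chord among the last \<open>k\<close> points leads to the same recursion: at the first of these \<open>k\<close> points, the
  term \<open>s\<close> of the weight \<open>s + 1\<close> selects an isolated chord, and such a chord cuts the pairing into an
  inner and an outer one.\<close>

section \<open>Pairings and isolated chords\<close>

definition pairings_on :: "'a set \<Rightarrow> 'a set set set" where
  "pairings_on A = {P. partition_on A P \<and> (\<forall>B\<in>P. card B = 2)}"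

lemma pairings_eq: "pairings n = pairings_on {1..n}"
  by (simp add: pairings_def pairings_on_def)

lemma finite_pairings_on: "finite A \<Longrightarrow> finite (pairings_on A)"
  unfolding pairings_on_def by (rule finite_subset[OF _ finitely_many_partition_on]) auto

lemma pairings_onD:
  assumes "P \<in> pairings_on A"
  shows "\<Union>P = A" "disjoint P" "\<And>B. B \<in> P \<Longrightarrow> card B = 2" "\<And>B. B \<in> P \<Longrightarrow> B \<subseteq> A"
  using assms by (auto simp: pairings_on_def partition_on_def)

lemma pairings_onI:
  assumes "\<Union>P = A" "disjoint P" "\<And>B. B \<in> P \<Longrightarrow> card B = 2"
  shows "P \<in> pairings_on A"
  using assms unfolding pairings_on_def partition_on_def by force

lemma finite_pairing: "finite A \<Longrightarrow> P \<in> pairings_on A \<Longrightarrow> finite P"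
  using finite_elements pairings_on_def by fastforce

lemma pairings_on_empty: "pairings_on {} = {{}}"
  by (auto simp: pairings_on_def partition_on_empty)

lemma insert_chord:
  assumes "\<rho> \<in> pairings_on (A - {p, q})" "p \<in> A" "q \<in> A" "p \<noteq> q"
  shows "insert {p, q} \<rho> \<in> pairings_on A"
  using pairings_onD[OF assms(1)] assms(2-)
  by (intro pairings_onI) (auto simp: disjoint_def)

lemma remove_chord:
  assumes "P \<in> pairings_on A" "{p, q} \<in> P"
  shows "P - {{p, q}} \<in> pairings_on (A - {p, q})"
proof (rule pairings_onI)
  note P = pairings_onD[OF assms(1)]
  have "B \<inter> {p, q} = {}" if "B \<in> P" "B \<noteq> {p, q}" for B
    using disjointD[OF P(2) that(1) assms(2) that(2)] .
  then show "\<Union> (P - {{p, q}}) = A - {p, q}"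
    using P(1) assms(2) by blast
  show "disjoint (P - {{p, q}})"
    using P(2) by (auto simp: disjoint_def)
qed (use pairings_onD[OF assms(1)] in auto)

lemma chord_at:
  assumes "P \<in> pairings_on A" "p \<in> A"
  obtains q where "q \<in> A" "q \<noteq> p" "{p, q} \<in> P"
proof -
  note P = pairings_onD[OF assms(1)]
  obtain B where B: "B \<in> P" "p \<in> B" using P(1) assms(2) by blast
  then obtain q where "B = {p, q}" "q \<noteq> p"
    using P(3)[OF B(1)] by (auto simp: card_2_iff)
  with B P(4)[OF B(1)] that show ?thesis by auto
qed

text \<open>Every pairing has exactly one chord through \<open>p\<close>; sorting by its partner
  \<open>q\<close> and deleting that chord is a bijection.\<close>

lemma sum_pairings_on_remove:
  fixes f :: "'a set set \<Rightarrow> 'b::comm_monoid_add"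
  assumes "finite A" "p \<in> A"
  shows "sum f (pairings_on A) =
    (\<Sum>q\<in>A - {p}. \<Sum>\<rho>\<in>pairings_on (A - {p, q}). f (insert {p, q} \<rho>))"
proof -
  let ?S = "SIGMA q:A - {p}. pairings_on (A - {p, q})"
  let ?h = "\<lambda>(q, \<rho>). insert {p, q} \<rho>"
  have nin: "{p, q'} \<notin> \<rho>" if "\<rho> \<in> pairings_on (A - {p, q})" for q q' \<rho>
    using pairings_onD(4)[OF that, of "{p, q'}"] by auto
  have "bij_betw ?h ?S (pairings_on A)"
  proof (rule bij_betw_imageI)
    show "inj_on ?h ?S"
    proof (rule inj_onI)
      fix x y assume x: "x \<in> ?S" and y: "y \<in> ?S" and eq: "?h x = ?h y"
      obtain q \<rho> q' \<rho>' where xy: "x = (q, \<rho>)" "y = (q', \<rho>')" by fastforce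
      have \<rho>: "\<rho> \<in> pairings_on (A - {p, q})" "\<rho>' \<in> pairings_on (A - {p, q'})"
        using x y xy by auto
      have "{p, q} = {p, q'}" using nin[OF \<rho>(2)] eq xy by auto
      then have "q = q'" by (auto simp: doubleton_eq_iff)
      moreover from this have "\<rho> = \<rho>'"
        using eq xy nin[OF \<rho>(1)] nin[OF \<rho>(2)] by (simp add: insert_ident)
      ultimately show "x = y" using xy by simp
    qed
    show "?h ` ?S = pairings_on A"
    proof (intro equalityI subsetI)
      fix P assume "P \<in> ?h ` ?S"
      then show "P \<in> pairings_on A" by (auto intro!: insert_chord assms(2))
    next
      fix P assume P: "P \<in> pairings_on A"
      obtain q where q: "q \<in> A" "q \<noteq> p" "{p, q} \<in> P" using chord_at[OF P assms(2)] .
      have "(q, P - {{p, q}}) \<in> ?S" using q remove_chord[OF P q(3)] by auto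
      moreover have "P = ?h (q, P - {{p, q}})" using q by auto
      ultimately show "P \<in> ?h ` ?S" by blast
    qed
  qed
  then have "sum f (pairings_on A) = (\<Sum>x\<in>?S. f (?h x))"
    by (simp add: sum.reindex_bij_betw)
  also have "\<dots> = (\<Sum>q\<in>A - {p}. \<Sum>\<rho>\<in>pairings_on (A - {p, q}). f (insert {p, q} \<rho>))"
    using assms(1) by (subst sum.Sigma) (auto simp: finite_pairings_on intro!: sum.cong)
  finally show ?thesis .
qed

text \<open>A chord is non-empty, so it lies on only one of the disjoint sides, and the union
  determines both parts. This will separate the inside of an isolated chord from its
  outside.\<close>

lemma sum_pairings_on_split:
  fixes f :: "'a set set \<Rightarrow> 'b::comm_monoid_add"
  assumes "finite I" "finite J" "I \<inter> J = {}"
  shows "(\<Sum>\<rho> | \<rho> \<in> pairings_on (I \<union> J) \<and> (\<forall>D\<in>\<rho>. D \<subseteq> I \<or> D \<subseteq> J). f \<rho>) =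
    (\<Sum>\<rho>\<in>pairings_on I. \<Sum>\<rho>'\<in>pairings_on J. f (\<rho> \<union> \<rho>'))"
proof -
  let ?T = "{\<rho> \<in> pairings_on (I \<union> J). \<forall>D\<in>\<rho>. D \<subseteq> I \<or> D \<subseteq> J}"
  let ?h = "\<lambda>(\<rho>, \<rho>'). \<rho> \<union> \<rho>'"
  have part: "{D \<in> \<rho> \<union> \<rho>'. D \<subseteq> I} = \<rho>" "{D \<in> \<rho> \<union> \<rho>'. D \<subseteq> J} = \<rho>'"
    if "\<rho> \<in> pairings_on I" "\<rho>' \<in> pairings_on J" for \<rho> \<rho>'
  proof -
    have "\<not> D \<subseteq> J" if "D \<in> \<rho>" for D
      using pairings_onD(3,4)[OF \<open>\<rho> \<in> _\<close> that] assms(3)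
      by (metis Int_subset_iff card.empty subset_empty zero_neq_numeral)
    moreover have "\<not> D \<subseteq> I" if "D \<in> \<rho>'" for D
      using pairings_onD(3,4)[OF \<open>\<rho>' \<in> _\<close> that] assms(3)
      by (metis Int_subset_iff card.empty subset_empty zero_neq_numeral)
    ultimately show "{D \<in> \<rho> \<union> \<rho>'. D \<subseteq> I} = \<rho>" "{D \<in> \<rho> \<union> \<rho>'. D \<subseteq> J} = \<rho>'"
      using pairings_onD(4)[OF that(1)] pairings_onD(4)[OF that(2)] by blast+
  qed
  have "bij_betw ?h (pairings_on I \<times> pairings_on J) ?T"
  proof (rule bij_betw_imageI)
    show "inj_on ?h (pairings_on I \<times> pairings_on J)"
      by (rule inj_onI) (use part in \<open>clarsimp, metis\<close>)
    show "?h ` (pairings_on I \<times> pairings_on J) = ?T"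
    proof (intro equalityI subsetI)
      fix P assume "P \<in> ?h ` (pairings_on I \<times> pairings_on J)"
      then obtain \<rho> \<rho>' where *: "\<rho> \<in> pairings_on I" "\<rho>' \<in> pairings_on J" "P = \<rho> \<union> \<rho>'" by auto
      note 1 = pairings_onD[OF *(1)] and 2 = pairings_onD[OF *(2)]
      have "disjoint P"
        unfolding *(3) using 1 2 assms(3) by (intro disjoint_union) auto
      moreover have "\<Union>P = I \<union> J" "\<forall>B\<in>P. card B = 2" using 1 2 *(3) by auto
      ultimately have "P \<in> pairings_on (I \<union> J)" by (intro pairings_onI) auto
      then show "P \<in> ?T" using 1(4) 2(4) *(3) by blast
    next
      fix P assume P: "P \<in> ?T"
      then have P': "P \<in> pairings_on (I \<union> J)" by auto
      note PD = pairings_onD[OF P']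
      have U': "\<Union>{D \<in> P. D \<subseteq> I} = I" if "I \<inter> J = {}" "I \<subseteq> \<Union>P"
        "\<forall>D\<in>P. D \<subseteq> I \<or> D \<subseteq> J" for I J :: "'a set"
      proof (intro equalityI subsetI)
        fix x assume "x \<in> I"
        with that(2) obtain D where "D \<in> P" "x \<in> D" by blast
        with that \<open>x \<in> I\<close> show "x \<in> \<Union>{D \<in> P. D \<subseteq> I}" by blast
      qed auto
      have U: "\<Union>{D \<in> P. D \<subseteq> I} = I" "\<Union>{D \<in> P. D \<subseteq> J} = J"
      proof -
        have *: "\<forall>D\<in>P. D \<subseteq> I \<or> D \<subseteq> J" "\<forall>D\<in>P. D \<subseteq> J \<or> D \<subseteq> I" using P by auto
        show "\<Union>{D \<in> P. D \<subseteq> I} = I" using assms(3) PD(1) *(1) by (intro U'[of I J]) simp_all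
        show "\<Union>{D \<in> P. D \<subseteq> J} = J" using assms(3) PD(1) *(2) by (intro U'[of J I]) auto
      qed
      have "{D \<in> P. D \<subseteq> I} \<in> pairings_on I" "{D \<in> P. D \<subseteq> J} \<in> pairings_on J"
        using PD(2,3) U by (auto intro!: pairings_onI simp: disjoint_def)
      moreover have "P = {D \<in> P. D \<subseteq> I} \<union> {D \<in> P. D \<subseteq> J}" using P by auto
      ultimately show "P \<in> ?h ` (pairings_on I \<times> pairings_on J)" by (intro image_eqI[where x="(_, _)"]) auto
    qed
  qed
  then have "sum f ?T = (\<Sum>x\<in>pairings_on I \<times> pairings_on J. f (?h x))"
    by (simp add: sum.reindex_bij_betw)
  then show ?thesis by (simp add: sum.cartesian_product case_prod_unfold)
qed

text \<open>In each induction step the partner of a fixed point is chosen in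
  \<open>2 * r + 1\<close> ways. The double factorial is written with factorials to match the even
  normal moments.\<close>

lemma card_pairings_on:
  assumes "finite A"
  shows "card A = 2 * r \<Longrightarrow> real (card (pairings_on A)) = fact (2 * r) / (2 ^ r * fact r)"
  using assms
proof (induction r arbitrary: A)
  case 0
  then show ?case by (simp add: pairings_on_empty)
next
  case (Suc r)
  then obtain p where p: "p \<in> A" by fastforce
  have "real (card (pairings_on A)) = (\<Sum>P\<in>pairings_on A. 1)" by simp
  also have "\<dots> = (\<Sum>q\<in>A - {p}. real (card (pairings_on (A - {p, q}))))"
    by (subst sum_pairings_on_remove[OF Suc.prems(2) p]) simp
  also have "\<dots> = (\<Sum>q\<in>A - {p}. fact (2 * r) / (2 ^ r * fact r))"
    using Suc p by (intro sum.cong refl Suc.IH) (auto simp: card_Diff_subset)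
  also have "\<dots> = (2 * r + 1) * fact (2 * r) / (2 ^ r * fact r)"
    using Suc.prems p by (simp add: algebra_simps)
  also have "\<dots> = fact (2 * Suc r) / (2 ^ Suc r * fact (Suc r))"
    by (simp add: divide_simps) (simp add: algebra_simps)
  finally show ?case .
qed

lemma pairings_on_odd:
  assumes "odd (card A)"
  shows "pairings_on A = {}"
proof (rule ccontr)
  assume "pairings_on A \<noteq> {}"
  then obtain P where P: "P \<in> pairings_on A" by blast
  have "finite A" using assms card_ge_0_finite odd_pos by blast
  then have "card A = (\<Sum>B\<in>P. card B)"
    using P by (intro product_partition) (auto simp: pairings_on_def card_ge_0_finite)
  also have "\<dots> = 2 * card P" using pairings_onD(3)[OF P] by simp
  finally show False using assms by simp
qed

section \<open>Crossings and the weighted count of isolated chords\<close>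

lemma chords_cross_iff:
  assumes "p < q" "c < d"
  shows "chords_cross {p, q} {c, d} \<longleftrightarrow> p < c \<and> c < q \<and> q < d \<or> c < p \<and> p < d \<and> d < q"
proof
  assume "chords_cross {p, q} {c, d}"
  then obtain a b a' b' where *: "{{p, q}, {c, d}} = {{a, b}, {a', b'}}" "a < a'" "a' < b" "b < b'"
    unfolding chords_cross_def by blast
  from *(1) have "{p, q} = {a, b} \<and> {c, d} = {a', b'} \<or> {p, q} = {a', b'} \<and> {c, d} = {a, b}"
    by (simp add: doubleton_eq_iff[of "{p, q}"])
  then show "p < c \<and> c < q \<and> q < d \<or> c < p \<and> p < d \<and> d < q"
    using *(2-) assms by (auto simp: doubleton_eq_iff)
next
  assume "p < c \<and> c < q \<and> q < d \<or> c < p \<and> p < d \<and> d < q"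
  then show "chords_cross {p, q} {c, d}"
  proof (elim disjE)
    assume "p < c \<and> c < q \<and> q < d"
    then show ?thesis unfolding chords_cross_def by blast
  next
    assume "c < p \<and> p < d \<and> d < q"
    moreover have "{{p, q}, {c, d}} = {{c, d}, {p, q}}" by auto
    ultimately show ?thesis unfolding chords_cross_def by blast
  qed
qed

lemma chords_cross_sym: "chords_cross C D \<longleftrightarrow> chords_cross D C"
  by (simp add: chords_cross_def insert_commute)

lemma chord_ordered:
  fixes C :: "'a::linorder set"
  assumes "card C = 2"
  obtains c d where "C = {c, d}" "c < d"
proof -
  obtain x y where "C = {x, y}" "x \<noteq> y" using assms by (auto simp: card_2_iff)
  then show ?thesis using that[of x y] that[of y x] by (cases "x < y") (auto simp: insert_commute)
qed

text \<open>A crossing means exactly one endpoint inside the interval. In this set form, isolation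
  of \<open>{p, q}\<close> becomes the side condition of
  \<open>sum_pairings_on_split\<close>.\<close>

lemma chords_cross_inside_iff:
  assumes "p < q" "card D = 2" "D \<inter> {p, q} = {}"
  shows "chords_cross {p, q} D \<longleftrightarrow> \<not> (D \<subseteq> {p<..<q} \<or> D \<inter> {p<..<q} = {})"
proof -
  obtain c d where D: "D = {c, d}" "c < d" using chord_ordered[OF assms(2)] .
  show ?thesis unfolding D(1) chords_cross_iff[OF assms(1) D(2)]
    using assms D by auto
qed

lemma not_chords_cross_separated:
  assumes "card C = 2" "card D = 2" "C \<subseteq> {p<..<q}" "D \<inter> {p<..<q} = {}"
  shows "\<not> chords_cross C D"
proof -
  obtain a b where C: "C = {a, b}" "a < b" using chord_ordered[OF assms(1)] .
  obtain c d where D: "D = {c, d}" "c < d" using chord_ordered[OF assms(2)] .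
  show ?thesis unfolding C(1) D(1) chords_cross_iff[OF C(2) D(2)]
    using assms C D by auto
qed

text \<open>Letting \<open>K\<close> grow point by point interpolates between the plain number of
  pairings (\<open>K = {}\<close>) and the sum of the theorem (\<open>K = A\<close>).\<close>

definition isolated_sum :: "'b::comm_ring_1 \<Rightarrow> nat set \<Rightarrow> nat set \<Rightarrow> 'b" where
  "isolated_sum t A K = (\<Sum>\<pi>\<in>pairings_on A. t ^ card {C \<in> isolated_chords \<pi>. C \<subseteq> K})"

text \<open>Chords inside \<open>{p<..<q}\<close> and chords outside cross neither each other nor
  \<open>{p, q}\<close>, so isolation is decided on each side separately.\<close>

lemma isolated_chords_separated:
  assumes p: "p < q" and \<rho>: "\<rho> \<in> pairings_on I" and \<rho>': "\<rho>' \<in> pairings_on J"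
    and I: "I \<subseteq> {p<..<q}" and J: "J \<inter> {p..q} = {}"
  shows "isolated_chords (insert {p, q} (\<rho> \<union> \<rho>')) =
    insert {p, q} (isolated_chords \<rho> \<union> isolated_chords \<rho>')"
proof -
  note 1 = pairings_onD(3,4)[OF \<rho>] and 2 = pairings_onD(3,4)[OF \<rho>']
  have a: "\<not> chords_cross {p, q} D" if "D \<in> \<rho>" for D
  proof -
    have "D \<subseteq> {p<..<q}" using 1[OF that] I by auto
    moreover from this have "D \<inter> {p, q} = {}" by auto
    ultimately show ?thesis using chords_cross_inside_iff[OF p 1(1)[OF that]] by blast
  qed
  have b: "\<not> chords_cross {p, q} D" if "D \<in> \<rho>'" for D
  proof -
    have "D \<inter> {p..q} = {}" using 2[OF that] J by auto
    moreover from this have "D \<inter> {p, q} = {}" "D \<inter> {p<..<q} = {}" using p by auto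
    ultimately show ?thesis using chords_cross_inside_iff[OF p 2(1)[OF that]] by blast
  qed
  have c: "\<not> chords_cross C D" if "C \<in> \<rho>" "D \<in> \<rho>'" for C D
  proof (rule not_chords_cross_separated)
    show "C \<subseteq> {p<..<q}" using 1(2)[OF that(1)] I by auto
    show "D \<inter> {p<..<q} = {}" using 2(2)[OF that(2)] J by force
  qed (use that 1 2 in auto)
  have a': "\<not> chords_cross D {p, q}" if "D \<in> \<rho> \<union> \<rho>'" for D
    using a b that chords_cross_sym by blast
  have c': "\<not> chords_cross D C" if "C \<in> \<rho>" "D \<in> \<rho>'" for C D
    using c that chords_cross_sym by blast
  let ?P = "insert {p, q} (\<rho> \<union> \<rho>')"
  have iso1: "C \<in> isolated_chords ?P \<longleftrightarrow> C \<in> isolated_chords \<rho>" if "C \<in> \<rho>" for C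
    using a' c that by (auto simp: isolated_chords_def)
  have iso2: "C \<in> isolated_chords ?P \<longleftrightarrow> C \<in> isolated_chords \<rho>'" if "C \<in> \<rho>'" for C
    using a' c' that by (auto simp: isolated_chords_def)
  have 3: "{p, q} \<in> isolated_chords ?P"
    using a b by (auto simp: isolated_chords_def)
  have 4: "isolated_chords P \<subseteq> P" for P
    by (auto simp: isolated_chords_def)
  show ?thesis
  proof (intro equalityI subsetI)
    fix C assume C: "C \<in> isolated_chords ?P"
    with 4 have "C = {p, q} \<or> C \<in> \<rho> \<or> C \<in> \<rho>'" by blast
    with C iso1[of C] iso2[of C] show "C \<in> insert {p, q} (isolated_chords \<rho> \<union> isolated_chords \<rho>')"
      by fast
  next
    fix C assume "C \<in> insert {p, q} (isolated_chords \<rho> \<union> isolated_chords \<rho>')"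
    then consider "C = {p, q}" | "C \<in> isolated_chords \<rho>" | "C \<in> isolated_chords \<rho>'" by fast
    then show "C \<in> isolated_chords ?P"
    proof cases
      case 1
      then show ?thesis using 3 by simp
    next
      case 2
      then show ?thesis using 4[of \<rho>] iso1 by blast
    next
      case 3
      then show ?thesis using 4[of \<rho>'] iso2 by blast
    qed
  qed
qed

text \<open>Adding \<open>p\<close> to \<open>K\<close> affects only pairings that join
  \<open>p\<close> to some \<open>q \<in> K\<close> by an isolated chord: their weight gains a
  factor \<open>t\<close>, so \<open>t - 1\<close> times the old weight is added. Such a chord
  splits the pairing into the points between \<open>p\<close> and \<open>q\<close>, all of them in
  \<open>K\<close>, and the points outside.\<close>

lemma isolated_sum_insert:
  fixes t :: "'b::comm_ring_1"
  assumes fin: "finite A" and p: "p \<in> A" and K: "K = {x \<in> A. p < x}"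
  shows "isolated_sum t A (insert p K) = isolated_sum t A K + (t - 1) *
    (\<Sum>q\<in>K. isolated_sum t {x \<in> K. x < q} {x \<in> K. x < q} *
              isolated_sum t {x \<in> A. x < p \<or> q < x} {x \<in> K. q < x})"
proof -
  define I where "I q = {x \<in> K. x < q}" for q
  define J where "J q = {x \<in> A. x < p \<or> q < x}" for q
  define e where "e P L = t ^ card {C \<in> isolated_chords P. C \<subseteq> L}" for P L
  \<comment> \<open>For \<open>q \<in> K\<close> this expresses that no chord of
    \<open>\<rho>\<close> crosses \<open>{p, q}\<close>.\<close>
  define nc where "nc q \<rho> \<longleftrightarrow> (\<forall>D\<in>\<rho>. D \<subseteq> I q \<or> D \<subseteq> J q)" for q \<rho>
  have K': "K \<subseteq> A - {p}" "finite K" using K fin by auto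
  have IJ: "I q \<inter> J q = {}" "I q \<union> J q = A - {p, q}" "finite (I q)" "finite (J q)" if "q \<in> K" for q
    using that K fin by (auto simp: I_def J_def)
  have finI: "finite (isolated_chords P)" if "finite P" for P
    using that by (simp add: isolated_chords_def)
  have step: "e (insert {p, q} \<rho>) (insert p K) = e (insert {p, q} \<rho>) K +
      (if q \<in> K \<and> nc q \<rho> then (t - 1) * e (insert {p, q} \<rho>) K else 0)"
    if q: "q \<in> A - {p}" and \<rho>: "\<rho> \<in> pairings_on (A - {p, q})" for q \<rho>
  proof -
    let ?P = "insert {p, q} \<rho>"
    have PD: "C \<subseteq> insert p K \<longleftrightarrow> C \<subseteq> K" if "C \<in> \<rho>" for C
      using pairings_onD(4)[OF \<rho> that] by auto
    have iso_sub: "isolated_chords ?P \<subseteq> ?P" by (auto simp: isolated_chords_def)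
    show ?thesis
    proof (cases "q \<in> K \<and> {p, q} \<in> isolated_chords ?P")
      case False
      have "{C \<in> isolated_chords ?P. C \<subseteq> insert p K} = {C \<in> isolated_chords ?P. C \<subseteq> K}"
        using iso_sub PD False q by fastforce
      moreover have "\<not> (q \<in> K \<and> nc q \<rho>)"
      proof
        assume *: "q \<in> K \<and> nc q \<rho>"
        have "\<not> chords_cross {p, q} D" if D: "D \<in> \<rho>" for D
        proof -
          have "D \<subseteq> {p<..<q} \<or> D \<inter> {p<..<q} = {}"
            using * D K by (fastforce simp: nc_def I_def J_def)
          moreover have "p < q" using * K by auto
          moreover have "D \<inter> {p, q} = {}" "card D = 2" using pairings_onD(3,4)[OF \<rho> D] by auto
          ultimately show ?thesis by (simp add: chords_cross_inside_iff)
        qed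
        then have "{p, q} \<in> isolated_chords ?P" by (auto simp: isolated_chords_def)
        with * False show False by blast
      qed
      ultimately show ?thesis by (auto simp: e_def)
    next
      case True
      have "p < q" using True K by auto
      have "nc q \<rho>"
        unfolding nc_def
      proof
        fix D assume D: "D \<in> \<rho>"
        have "D \<inter> {p, q} = {}" "card D = 2" using pairings_onD(3,4)[OF \<rho> D] by auto
        moreover from this have "D \<noteq> {p, q}" by auto
        then have "\<not> chords_cross {p, q} D" using True D by (auto simp: isolated_chords_def)
        ultimately have "D \<subseteq> {p<..<q} \<or> D \<inter> {p<..<q} = {}"
          using chords_cross_inside_iff[OF \<open>p < q\<close>, of D] by blast
        then show "D \<subseteq> I q \<or> D \<subseteq> J q"
        proof
          assume "D \<subseteq> {p<..<q}"
          then show ?thesis using pairings_onD(4)[OF \<rho> D] K by (auto simp: I_def)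
        next
          assume *: "D \<inter> {p<..<q} = {}"
          have "x \<in> J q" if "x \<in> D" for x
          proof -
            have "x \<in> A" "x \<noteq> p" "x \<noteq> q" "\<not> (p < x \<and> x < q)"
              using pairings_onD(4)[OF \<rho> D] that * by auto
            then show ?thesis by (auto simp: J_def)
          qed
          then show ?thesis by blast
        qed
      qed
      moreover have "{C \<in> isolated_chords ?P. C \<subseteq> insert p K} =
          insert {p, q} {C \<in> isolated_chords ?P. C \<subseteq> K}"
        using iso_sub PD True by fastforce
      moreover have "p \<notin> K" using K by auto
      moreover have "finite {C \<in> isolated_chords ?P. C \<subseteq> K}"
        using finite_pairing[OF _ \<rho>] fin finI by simp
      ultimately show ?thesis using True by (simp add: e_def algebra_simps)
    qed
  qed
  have main: "(\<Sum>\<rho> | \<rho> \<in> pairings_on (A - {p, q}) \<and> nc q \<rho>. e (insert {p, q} \<rho>) K) =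
      isolated_sum t (I q) (I q) * isolated_sum t (J q) {x \<in> K. q < x}" if q: "q \<in> K" for q
  proof -
    have "p < q" using q K by auto
    have "(\<Sum>\<rho> | \<rho> \<in> pairings_on (A - {p, q}) \<and> nc q \<rho>. e (insert {p, q} \<rho>) K) =
        (\<Sum>\<rho>\<in>pairings_on (I q). \<Sum>\<rho>'\<in>pairings_on (J q). e (insert {p, q} (\<rho> \<union> \<rho>')) K)"
      unfolding nc_def IJ(2)[OF q, symmetric] by (rule sum_pairings_on_split) (use IJ[OF q] in auto)
    also have "\<dots> = (\<Sum>\<rho>\<in>pairings_on (I q). \<Sum>\<rho>'\<in>pairings_on (J q). e \<rho> (I q) * e \<rho>' {x \<in> K. q < x})"
    proof (intro sum.cong refl)
      fix \<rho> \<rho>' assume \<rho>: "\<rho> \<in> pairings_on (I q)" and \<rho>': "\<rho>' \<in> pairings_on (J q)"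
      have ne: "C \<noteq> {}" if "C \<in> \<rho> \<union> \<rho>'" for C
        using that pairings_onD(3)[OF \<rho>] pairings_onD(3)[OF \<rho>'] by force
      have sub: "isolated_chords \<rho> \<subseteq> \<rho>" "isolated_chords \<rho>' \<subseteq> \<rho>'" by (auto simp: isolated_chords_def)
      have "isolated_chords (insert {p, q} (\<rho> \<union> \<rho>')) =
          insert {p, q} (isolated_chords \<rho> \<union> isolated_chords \<rho>')"
        using \<open>p < q\<close> \<rho> \<rho>' by (rule isolated_chords_separated) (use K q in \<open>auto simp: I_def J_def\<close>)
      moreover have "C \<subseteq> K \<longleftrightarrow> C \<subseteq> I q" if "C \<in> isolated_chords \<rho>" for C
        using pairings_onD(4)[OF \<rho>] sub that by (auto simp: I_def)
      moreover have "J q \<inter> K = {x \<in> K. q < x}"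
        using K by (auto simp: J_def)
      then have "C \<subseteq> K \<longleftrightarrow> C \<subseteq> {x \<in> K. q < x}" if "C \<in> isolated_chords \<rho>'" for C
        using pairings_onD(4)[OF \<rho>'] sub that by blast
      \<comment> \<open>The chord \<open>{p, q}\<close> is not counted here; its contribution is the
        factor \<open>t - 1\<close> in \<open>step\<close>.\<close>
      moreover have "\<not> {p, q} \<subseteq> K" using K by auto
      ultimately have "{C \<in> isolated_chords (insert {p, q} (\<rho> \<union> \<rho>')). C \<subseteq> K} =
          {C \<in> isolated_chords \<rho>. C \<subseteq> I q} \<union> {C \<in> isolated_chords \<rho>'. C \<subseteq> {x \<in> K. q < x}}"
        (is "_ = ?X \<union> ?Y") by (intro set_eqI) (simp only: mem_Collect_eq Un_iff insert_iff, blast)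
      moreover have "?X \<inter> ?Y = {}" using ne sub by (fastforce simp: I_def)
      moreover have "finite ?X" "finite ?Y"
        using finite_pairing[OF _ \<rho>] finite_pairing[OF _ \<rho>'] IJ[OF q] finI by auto
      ultimately show "e (insert {p, q} (\<rho> \<union> \<rho>')) K = e \<rho> (I q) * e \<rho>' {x \<in> K. q < x}"
        by (simp add: e_def card_Un_disjoint power_add)
    qed
    also have "\<dots> = isolated_sum t (I q) (I q) * isolated_sum t (J q) {x \<in> K. q < x}"
      by (simp add: isolated_sum_def e_def sum_product)
    finally show ?thesis .
  qed
  have "isolated_sum t A (insert p K) =
      (\<Sum>q\<in>A - {p}. \<Sum>\<rho>\<in>pairings_on (A - {p, q}). e (insert {p, q} \<rho>) K) +
      (\<Sum>q\<in>A - {p}. \<Sum>\<rho>\<in>pairings_on (A - {p, q}).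
         if q \<in> K \<and> nc q \<rho> then (t - 1) * e (insert {p, q} \<rho>) K else 0)"
    unfolding isolated_sum_def e_def[symmetric] sum_pairings_on_remove[OF fin p]
    by (simp add: step sum.distrib)
  also have "(\<Sum>q\<in>A - {p}. \<Sum>\<rho>\<in>pairings_on (A - {p, q}). e (insert {p, q} \<rho>) K) = isolated_sum t A K"
    unfolding isolated_sum_def e_def[symmetric] sum_pairings_on_remove[OF fin p] ..
  also have "(\<Sum>q\<in>A - {p}. \<Sum>\<rho>\<in>pairings_on (A - {p, q}).
         if q \<in> K \<and> nc q \<rho> then (t - 1) * e (insert {p, q} \<rho>) K else 0) =
      (\<Sum>q\<in>K. \<Sum>\<rho>\<in>pairings_on (A - {p, q}). if nc q \<rho> then (t - 1) * e (insert {p, q} \<rho>) K else 0)"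
    using fin K' by (intro sum.mono_neutral_cong_right) (auto simp: finite_pairings_on)
  also have "\<dots> = (\<Sum>q\<in>K. (t - 1) * (isolated_sum t (I q) (I q) * isolated_sum t (J q) {x \<in> K. q < x}))"
  proof (rule sum.cong[OF refl])
    fix q assume q: "q \<in> K"
    have "(\<Sum>\<rho>\<in>pairings_on (A - {p, q}). if nc q \<rho> then (t - 1) * e (insert {p, q} \<rho>) K else 0) =
        (\<Sum>\<rho> | \<rho> \<in> pairings_on (A - {p, q}) \<and> nc q \<rho>. (t - 1) * e (insert {p, q} \<rho>) K)"
      using fin by (intro sum.inter_filter[symmetric]) (simp add: finite_pairings_on)
    then show "(\<Sum>\<rho>\<in>pairings_on (A - {p, q}). if nc q \<rho> then (t - 1) * e (insert {p, q} \<rho>) K else 0) =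
        (t - 1) * (isolated_sum t (I q) (I q) * isolated_sum t (J q) {x \<in> K. q < x})"
      unfolding main[OF q, symmetric] sum_distrib_left .
  qed
  finally show ?thesis unfolding I_def J_def sum_distrib_left .
qed

text \<open>The rank of \<open>q\<close> in \<open>K\<close> takes each of the values
  \<open>0, ..., card K - 1\<close> once. Sums over partners \<open>q\<close> thus become the index
  sums in the recursion for \<open>F\<close>.\<close>

lemma sum_by_rank:
  fixes K :: "'a::linorder set"
  assumes "finite K"
  shows "(\<Sum>q\<in>K. h (card {x \<in> K. x < q})) = (\<Sum>i<card K. h i)"
  using assms
proof (induction K rule: finite_linorder_max_induct)
  case empty
  then show ?case by simp
next
  case (insert b K)
  have "{x \<in> insert b K. x < b} = K" using insert.hyps by auto
  moreover have "{x \<in> insert b K. x < q} = {x \<in> K. x < q}" if "q \<in> K" for q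
    using insert.hyps that by force
  moreover have "b \<notin> K" using insert.hyps by auto
  ultimately show ?case using insert by (simp add: add.commute)
qed

text \<open>Both sides obey the same recursion: \<open>isolated_sum_insert\<close> at the least
  point of \<open>K\<close> matches \<open>F_Suc\<close>, and \<open>K = {}\<close> matches
  \<open>F_0\<close>. Since \<open>F\<close> sees only how many points lie before \<open>K\<close>
  and in \<open>K\<close>, the induction runs over \<open>card K\<close> for all \<open>A\<close> at
  once.\<close>

lemma isolated_sum_unique:
  fixes F :: "nat \<Rightarrow> nat \<Rightarrow> 'b::comm_ring_1"
  assumes F_0: "\<And>A :: nat set. finite A \<Longrightarrow> F (card A) 0 = \<sigma> ^ card A * of_nat (card (pairings_on A))"
    and F_Suc: "\<And>n k. F n (Suc k) = F (Suc n) k + s * \<sigma>\<^sup>2 * (\<Sum>i<k. F 0 i * F n (k - Suc i))"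
    and "finite A" "K \<subseteq> A" "\<And>x y. x \<in> A - K \<Longrightarrow> y \<in> K \<Longrightarrow> x < y"
  shows "F (card (A - K)) (card K) = \<sigma> ^ card A * isolated_sum (s + 1) A K"
  using assms(3-)
proof (induction "card K" arbitrary: A K rule: less_induct)
  case less
  have finK: "finite K" using less.prems finite_subset by blast
  show ?case
  proof (cases "K = {}")
    case True
    \<comment> \<open>Chords are non-empty, so for \<open>K = {}\<close> every pairing has weight
      one.\<close>
    have "{C \<in> isolated_chords \<pi>. C \<subseteq> {}} = {}" if "\<pi> \<in> pairings_on A" for \<pi>
      using pairings_onD(3)[OF that, of "{}"] by (auto simp: isolated_chords_def)
    then have "isolated_sum (s + 1) A {} = of_nat (card (pairings_on A))"
      unfolding isolated_sum_def by (subst sum.cong[OF refl, where h = "\<lambda>_. 1"]) (simp_all only: card.empty power_0 sum_constant mult_1_right)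
    then show ?thesis using True less.prems F_0 by simp
  next
    case False
    \<comment> \<open>With the least point, the rest of \<open>K\<close> is everything in
      \<open>A\<close> above it, as \<open>isolated_sum_insert\<close> requires.\<close>
    define p where "p = Min K"
    define K' where "K' = K - {p}"
    have p: "p \<in> K" "\<And>x. x \<in> K \<Longrightarrow> p \<le> x" using False finK by (auto simp: p_def)
    have K: "K = insert p K'" "finite K'" "p \<notin> K'" using p finK by (auto simp: K'_def)
    have K': "K' = {x \<in> A. p < x}" using less.prems p by (force simp: K'_def)
    have low: "{x \<in> A. x < p} = A - K" using less.prems p by force
    have cK: "card K = Suc (card K')" using K by simp
    have "F (card (A - K)) (card K) = F (Suc (card (A - K))) (card K') +
        s * \<sigma>\<^sup>2 * (\<Sum>i<card K'. F 0 i * F (card (A - K)) (card K' - Suc i))"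
      unfolding cK F_Suc ..
    also have "Suc (card (A - K)) = card (A - K')"
    proof -
      have "A - K' = insert p (A - K)" using K p less.prems by auto
      then show ?thesis using p less.prems by simp
    qed
    also have "F (card (A - K')) (card K') = \<sigma> ^ card A * isolated_sum (s + 1) A K'"
    proof (rule less.hyps)
      show "x < y" if "x \<in> A - K'" "y \<in> K'" for x y
      proof -
        have "x \<le> p" "p < y" using that K' by auto
        then show ?thesis by simp
      qed
    qed (use less.prems cK K' in auto)
    also have "(\<Sum>i<card K'. F 0 i * F (card (A - K)) (card K' - Suc i)) =
        (\<Sum>q\<in>K'. F 0 (card {x \<in> K'. x < q}) * F (card (A - K)) (card K' - Suc (card {x \<in> K'. x < q})))"
      by (rule sum_by_rank[symmetric]) fact
    also have "s * \<sigma>\<^sup>2 * \<dots> = (\<Sum>q\<in>K'. \<sigma> ^ card A * (s *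
        (isolated_sum (s + 1) {x \<in> K'. x < q} {x \<in> K'. x < q} *
         isolated_sum (s + 1) {x \<in> A. x < p \<or> q < x} {x \<in> K'. q < x})))"
      unfolding sum_distrib_left
    proof (rule sum.cong[OF refl])
      fix q assume q: "q \<in> K'"
      let ?I = "{x \<in> K'. x < q}" and ?J = "{x \<in> A. x < p \<or> q < x}" and ?L = "{x \<in> K'. q < x}"
      have pq: "p < q" using q K' by auto
      have "K' = insert q (?I \<union> ?L)" using q by auto
      moreover have "card (insert q (?I \<union> ?L)) = Suc (card ?I + card ?L)"
        using K(2) by (subst card_insert_disjoint) (auto intro!: card_Un_disjoint)
      ultimately have cK': "card K' = Suc (card ?I + card ?L)" by simp
      have "A = insert p (insert q (?I \<union> ?J))" using q p K K' less.prems by auto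
      moreover have "card (insert p (insert q (?I \<union> ?J))) = card ?I + card ?J + 2"
        using K(2) pq less.prems(1) K'
        by (subst card_insert_disjoint; (subst card_insert_disjoint)?) (auto intro!: card_Un_disjoint)
      \<comment> \<open>The two extra points are \<open>p\<close> and \<open>q\<close>; they account
        for the factor \<open>\<sigma>\<^sup>2\<close> of the recursion.\<close>
      ultimately have cA: "card A = card ?I + card ?J + 2" by simp
      have 1: "F 0 (card ?I) = \<sigma> ^ card ?I * isolated_sum (s + 1) ?I ?I"
      proof -
        have "F (card (?I - ?I)) (card ?I) = \<sigma> ^ card ?I * isolated_sum (s + 1) ?I ?I"
        proof (rule less.hyps)
          show "card ?I < card K" using cK cK' by linarith
        qed (use K(2) in auto)
        then show ?thesis by (simp only: Diff_cancel card.empty)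
      qed
      have "F (card (?J - ?L)) (card ?L) = \<sigma> ^ card ?J * isolated_sum (s + 1) ?J ?L"
      proof (rule less.hyps)
        show "card ?L < card K" using cK cK' by linarith
        show "?L \<subseteq> ?J" using K' by auto
        show "x < y" if "x \<in> ?J - ?L" "y \<in> ?L" for x y
        proof -
          have "x < p" "p < y" using that K' pq by auto
          then show ?thesis by simp
        qed
      qed (use less.prems in simp)
      \<comment> \<open>Outside the chord, the points before the weighted ones are still those below
        \<open>p\<close>, so the first argument of \<open>F\<close> is unchanged.\<close>
      moreover have "?J - ?L = A - K"
        unfolding low[symmetric] K' using pq by auto
      ultimately have 2: "F (card (A - K)) (card K' - Suc (card ?I)) = \<sigma> ^ card ?J * isolated_sum (s + 1) ?J ?L"
        by (simp only: cK' diff_add_inverse diff_Suc_Suc)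
      show "s * \<sigma>\<^sup>2 * (F 0 (card ?I) * F (card (A - K)) (card K' - Suc (card ?I))) =
        \<sigma> ^ card A * (s * (isolated_sum (s + 1) ?I ?I * isolated_sum (s + 1) ?J ?L))"
        unfolding 1 2 cA power_add by (simp add: mult_ac)
    qed
    also have "\<sigma> ^ card A * isolated_sum (s + 1) A K' + \<dots> = \<sigma> ^ card A * isolated_sum (s + 1) A K"
    proof -
      have "p \<in> A" using p less.prems by auto
      then show ?thesis
        unfolding K(1) using isolated_sum_insert[OF less.prems(1) _ K', of "s + 1"]
        by (simp only: sum_distrib_left[symmetric] distrib_left add_diff_cancel_right')
    qed
    finally show ?thesis .
  qed
qed

section \<open>Moments of the normal and the semicircle law\<close>

text \<open>The Wick formula for one Gaussian variable, which supplies the initial values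
  \<open>F n 0\<close>. Odd moments fit in because an odd set has no pairings.\<close>

lemma normal_moment:
  fixes \<sigma> :: real
  assumes "\<sigma> > 0" "finite A"
  shows "(\<integral>x. x ^ card A \<partial>density lborel (normal_density 0 \<sigma>)) = \<sigma> ^ card A * card (pairings_on A)"
proof -
  have "(\<integral>x. x ^ card A \<partial>density lborel (normal_density 0 \<sigma>)) =
      (\<integral>x. normal_density 0 \<sigma> x * x ^ card A \<partial>lborel)"
    by (subst integral_density) auto
  also have "\<dots> = \<sigma> ^ card A * card (pairings_on A)"
  proof (cases "even (card A)")
    case True
    then obtain r where r: "card A = 2 * r" by blast
    show ?thesis
      using integral_normal_moment_even[OF assms(1), of 0 r] card_pairings_on[OF assms(2) r] r
      by (simp add: power_divide power_mult)
  next
    case False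
    then obtain r where r: "card A = 2 * r + 1" by (blast elim: oddE)
    show ?thesis
      using integral_normal_moment_odd[OF assms(1), of 0 r] pairings_on_odd[OF False] r by simp
  qed
  finally show ?thesis .
qed

text \<open>The rescaled Chebyshev polynomials of the second kind \<open>v\<^sup>m\<^sup>/\<^sup>2 U\<^sub>m(x / (2 \<surd>v))\<close>.\<close>

fun chebyshev :: "real \<Rightarrow> nat \<Rightarrow> real \<Rightarrow> real" where
  "chebyshev v 0 x = 1"
| "chebyshev v (Suc 0) x = x"
| "chebyshev v (Suc (Suc m)) x = x * chebyshev v (Suc m) x - v * chebyshev v m x"

lemma continuous_chebyshev [continuous_intros]: "continuous_on S (chebyshev v m)"
\<comment> \<open>The induction rule also ranges over the argument of the polynomial. Continuity is
  not a pointwise claim, so a dummy value is passed.\<close>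
proof (induction v m "0::real" rule: chebyshev.induct)
  case (1 v) show ?case by (simp cong: continuous_on_cong)
next
  case (2 v) show ?case by (simp cong: continuous_on_cong)
next
  case (3 v m)
  have "chebyshev v (Suc (Suc m)) = (\<lambda>x. x * chebyshev v (Suc m) x - v * chebyshev v m x)" by auto
  then show ?case using 3 by (auto intro!: continuous_intros)
qed

text \<open>A rescaled form of \<open>U_m(cos x) sin x = sin((m + 1) x)\<close>. The argument
  \<open>- 2 * r * cos x\<close> is increasing on \<open>{0..pi}\<close>, which suits the later
  substitution; its sign turns \<open>r ^ m\<close> into \<open>(- r) ^ m\<close> by parity.\<close>

lemma chebyshev_trig:
  "chebyshev (r\<^sup>2) m (- 2 * r * cos x) * sin x = (- r) ^ m * sin (real (Suc m) * x)"
proof (induction m rule: induct_nat_012)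
  case 0 show ?case by simp
next
  case 1
  show ?case using sin_double[of x] by (simp add: mult_ac)
next
  case (ge2 m)
  have "sin (real (Suc m) * x) + sin (real (Suc (Suc (Suc m))) * x) =
      2 * cos x * sin (real (Suc (Suc m)) * x)"
    using sin_plus_sin[of "real (Suc (Suc (Suc m))) * x" "real (Suc m) * x"]
    by (simp add: algebra_simps add_divide_distrib diff_divide_distrib)
  then have *: "sin (real (Suc (Suc (Suc m))) * x) =
      2 * cos x * sin (real (Suc (Suc m)) * x) - sin (real (Suc m) * x)" by linarith
  have "chebyshev (r\<^sup>2) (Suc (Suc m)) (- 2 * r * cos x) * sin x =
     - 2 * r * cos x * (chebyshev (r\<^sup>2) (Suc m) (- 2 * r * cos x) * sin x)
     - r\<^sup>2 * (chebyshev (r\<^sup>2) m (- 2 * r * cos x) * sin x)"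
    by (simp add: algebra_simps)
  then show ?case unfolding ge2 * by (simp add: algebra_simps power2_eq_square)
qed

lemma integral_sin_mult_sin:
  assumes "m > 0"
  shows "((\<lambda>x. sin (real (Suc m) * x) * sin x) has_integral 0) {0..pi}"
proof -
  \<comment> \<open>An antiderivative found by the product-to-sum formula; the division by
    \<open>m\<close> is where \<open>m > 0\<close> enters.\<close>
  let ?G = "\<lambda>x. (sin (real m * x) / real m - sin (real (m + 2) * x) / real (m + 2)) / 2"
  have "((\<lambda>x. (cos (real m * x) - cos (real (m + 2) * x)) / 2) has_integral (?G pi - ?G 0)) {0..pi}"
    using assms by (intro fundamental_theorem_of_calculus)
      (auto intro!: derivative_eq_intros simp flip: has_real_derivative_iff_has_vector_derivative
         simp del: of_nat_add)
  moreover have "?G pi - ?G 0 = 0"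
    unfolding sin_npi by simp
  moreover have "(cos (real m * x) - cos (real (m + 2) * x)) / 2 = sin (real (Suc m) * x) * sin x" for x
    using cos_diff_cos[of "real m * x" "real (m + 2) * x"]
    by (simp add: algebra_simps add_divide_distrib)
  ultimately show ?thesis by simp
qed

text \<open>Substituting \<open>- 2 * r * cos x\<close> turns the semicircle weight into a squared
  sine, and the claim into the orthogonality of \<open>sin ((m + 1) x)\<close> and
  \<open>sin x\<close>.\<close>

lemma integral_chebyshev:
  fixes r :: real
  assumes "r > 0" "m > 0"
  shows "integral {- 2 * r..2 * r} (\<lambda>x. chebyshev (r\<^sup>2) m x * sqrt (4 * r\<^sup>2 - x\<^sup>2)) = 0"
proof -
  let ?f = "\<lambda>x. chebyshev (r\<^sup>2) m x * sqrt (4 * r\<^sup>2 - x\<^sup>2)"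
  have sub: "((\<lambda>x. (2 * r * sin x) *\<^sub>R ?f (- 2 * r * cos x)) has_integral
      integral {- 2 * r * cos 0..- 2 * r * cos pi} ?f) {0..pi}"
  proof (rule has_integral_substitution)
    show "(\<lambda>x. - 2 * r * cos x) ` {0..pi} \<subseteq> {- 2 * r..2 * r}"
    proof (rule image_subsetI)
      fix x :: real
      have "r * cos x \<le> r * 1" "r * (- 1) \<le> r * cos x"
        using assms by (intro mult_left_mono; simp)+
      then show "- 2 * r * cos x \<in> {- 2 * r..2 * r}" by simp
    qed
  qed (use assms in \<open>auto intro!: continuous_intros derivative_eq_intros\<close>)
  have eq: "(2 * r * sin x) *\<^sub>R ?f (- 2 * r * cos x) =
      (4 * r\<^sup>2 * (- r) ^ m) * (sin (real (Suc m) * x) * sin x)" if "x \<in> {0..pi}" for x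
  proof -
    have "4 * r\<^sup>2 - (- 2 * r * cos x)\<^sup>2 = (2 * r * sin x)\<^sup>2"
      by (simp add: power_mult_distrib sin_squared_eq algebra_simps)
    \<comment> \<open>Without the sign, the root would only be known to be the absolute
      value.\<close>
    moreover have "0 \<le> 2 * r * sin x" using that assms by (simp add: sin_ge_zero)
    ultimately have "sqrt (4 * r\<^sup>2 - (- 2 * r * cos x)\<^sup>2) = 2 * r * sin x" by (metis real_sqrt_unique)
    then have "(2 * r * sin x) *\<^sub>R ?f (- 2 * r * cos x) =
        4 * r\<^sup>2 * (chebyshev (r\<^sup>2) m (- 2 * r * cos x) * sin x) * sin x"
      by (simp add: power2_eq_square)
    then show ?thesis unfolding chebyshev_trig by (simp add: mult_ac)
  qed
  have "((\<lambda>x. (4 * r\<^sup>2 * (- r) ^ m) * (sin (real (Suc m) * x) * sin x)) has_integral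
      integral {- 2 * r..2 * r} ?f) {0..pi}"
    using has_integral_eq[OF eq sub] by (simp only: cos_zero cos_pi mult_1_right mult_minus_right
        mult_minus_left minus_minus)
  moreover have "((\<lambda>x. (4 * r\<^sup>2 * (- r) ^ m) * (sin (real (Suc m) * x) * sin x)) has_integral
      (4 * r\<^sup>2 * (- r) ^ m) * 0) {0..pi}"
    by (intro has_integral_mult_right integral_sin_mult_sin assms)
  ultimately have "integral {- 2 * r..2 * r} ?f = (4 * r\<^sup>2 * (- r) ^ m) * 0"
    by (rule has_integral_unique)
  then show ?thesis by simp
qed

text \<open>The density vanishes off a compact interval, so everything reduces to integrating a
  continuous function there.\<close>

lemma semicircle_integral:
  assumes "v > 0" "continuous_on {- 2 * sqrt v..2 * sqrt v} h" "h \<in> borel_measurable borel"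
  shows "integrable (density lborel (semicircle_density v)) h"
    and "(\<integral>x. h x \<partial>density lborel (semicircle_density v)) =
      integral {- 2 * sqrt v..2 * sqrt v} (\<lambda>x. h x * sqrt (4 * v - x\<^sup>2)) / (2 * pi * v)"
proof -
  let ?S = "{- 2 * sqrt v..2 * sqrt v}"
  let ?f = "\<lambda>x. h x * sqrt (4 * v - x\<^sup>2) / (2 * pi * v)"
  have [measurable]: "semicircle_density v \<in> borel_measurable borel"
    unfolding semicircle_density_def by measurable
  \<comment> \<open>\<open>sqrt\<close> is negative on negative arguments, so the sign of the
    radicand has to be checked before the density is known to be non-negative.\<close>
  have "0 \<le> 4 * v - x\<^sup>2" if "x \<in> ?S" for x
  proof -
    have "x\<^sup>2 \<le> (2 * sqrt v)\<^sup>2" using that by (intro abs_le_square_iff[THEN iffD1]) (auto simp: assms)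
    then show ?thesis using assms by (simp add: power_mult_distrib)
  qed
  then have nn: "0 \<le> semicircle_density v x" for x
    using assms by (auto simp: semicircle_density_def)
  have eq: "semicircle_density v x *\<^sub>R h x = indicator ?S x *\<^sub>R ?f x" for x
    by (simp add: semicircle_density_def)
  have si: "set_integrable lborel ?S ?f"
    using assms by (intro borel_integrable_atLeastAtMost') (auto intro!: continuous_intros)
  have "integrable lborel (\<lambda>x. semicircle_density v x *\<^sub>R h x)"
    using si unfolding eq set_integrable_def .
  then show "integrable (density lborel (semicircle_density v)) h"
    using assms(3) nn by (subst integrable_density) auto
  have "(\<integral>x. h x \<partial>density lborel (semicircle_density v)) = (LINT x:?S|lborel. ?f x)"
    using assms(3) nn unfolding set_lebesgue_integral_def eq[symmetric]
    by (subst integral_density) auto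
  also have "\<dots> = integral ?S ?f" by (rule set_borel_integral_eq_integral(2)[OF si])
  finally show "(\<integral>x. h x \<partial>density lborel (semicircle_density v)) =
      integral ?S (\<lambda>x. h x * sqrt (4 * v - x\<^sup>2)) / (2 * pi * v)" by simp
qed

lemma semicircle_chebyshev:
  assumes "v > 0"
  shows "integrable (density lborel (semicircle_density v)) (\<lambda>x. x ^ n * chebyshev v m x)"
    and "m > 0 \<Longrightarrow> (\<integral>x. chebyshev v m x \<partial>density lborel (semicircle_density v)) = 0"
proof -
  have meas: "chebyshev v m \<in> borel_measurable borel"
    by (intro borel_measurable_continuous_onI continuous_intros)
  show "integrable (density lborel (semicircle_density v)) (\<lambda>x. x ^ n * chebyshev v m x)"
    using assms meas by (intro semicircle_integral) (auto intro!: continuous_intros)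
  show "(\<integral>x. chebyshev v m x \<partial>density lborel (semicircle_density v)) = 0" if "m > 0"
    using semicircle_integral(2)[OF assms, of "chebyshev v m"] integral_chebyshev[of "sqrt v" m]
      assms that meas by (simp add: continuous_intros)
qed

section \<open>Free Gaussian and semicircular variables\<close>

context star_prob_space
begin

section \<open>Linearity of the state and closure of generated algebras\<close>

lemma state_zero: "\<phi> 0 = 0"
  using state_add[of 0 0] by simp

lemma state_sum: "\<phi> (sum f A) = (\<Sum>x\<in>A. \<phi> (f x))"
  by (induction A rule: infinite_finite_induct) (simp_all add: state_zero state_add)

lemma state_diff: "\<phi> (a - b) = \<phi> a - \<phi> b"
  using state_add[of "a - b" b] by simp

lemma generated_algebra_diff:
  assumes "a \<in> generated_algebra smul S" "b \<in> generated_algebra smul S"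
  shows "a - b \<in> generated_algebra smul S"
  using generated_algebra.add[OF assms(1) generated_algebra.smul[OF assms(2), of "- 1"]] by simp

lemma generated_algebra_zero: "0 \<in> generated_algebra smul S"
  using generated_algebra_diff[OF generated_algebra.one generated_algebra.one] by simp

lemma generated_algebra_sum:
  "(\<And>x. x \<in> A \<Longrightarrow> f x \<in> generated_algebra smul S) \<Longrightarrow> sum f A \<in> generated_algebra smul S"
  by (induction A rule: infinite_finite_induct)
     (auto intro: generated_algebra_zero generated_algebra.add)

text \<open>\<open>wick v Y [a\<^sub>0, \<dots>, a\<^sub>d]\<close> is the element \<open>a\<^sub>0 Y a\<^sub>1 \<cdots> Y a\<^sub>d\<close> with all contractions of two
  factors \<open>Y\<close> subtracted: the element which creates \<open>a\<^sub>0 \<otimes> \<cdots> \<otimes> a\<^sub>d\<close> from the vacuum of the full Fock space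
  on which an operator-valued semicircular \<open>Y\<close> with covariance \<open>a \<mapsto> v \<phi>(a)\<close> acts as creation plus
  annihilation.\<close>

fun wick :: "complex \<Rightarrow> 'a \<Rightarrow> 'a list \<Rightarrow> 'a" where
  "wick v Y [] = 0"
| "wick v Y [a] = a"
| "wick v Y (a # b # L) = a * (Y * wick v Y (b # L) - smul (v * \<phi> b) (wick v Y L))"

section \<open>Algebra of Wick elements and their centering\<close>

lemma wick_mult: "wick v Y (c * a # L) = c * wick v Y (a # L)"
  by (cases L) (simp_all add: mult.assoc)

text \<open>The cases follow the position of the slot: the first entry is a left factor, the second
  also enters through \<open>\<phi>\<close>, and later ones are reached by the recursion.\<close>

lemma wick_add: "wick v Y (P @ (a + b) # L) = wick v Y (P @ a # L) + wick v Y (P @ b # L)"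
proof (induction P rule: induct_list012)
  case 1
  show ?case by (cases L) (simp_all add: algebra_simps)
next
  case (2 x)
  show ?case by (cases L) (simp_all add: algebra_simps state_add scale_left_distrib)
next
  case (3 x y zs)
  then show ?case by (simp add: algebra_simps scale_right_distrib)
qed

lemma wick_scale: "wick v Y (P @ smul c a # L) = smul c (wick v Y (P @ a # L))"
proof (induction P rule: induct_list012)
  case 1
  show ?case by (cases L) (simp_all add: mult_scale_left)
next
  case (2 x)
  show ?case
    by (cases L) (simp_all add: mult_scale_left mult_scale_right state_scale scale_right_diff_distrib
      right_diff_distrib mult_ac)
next
  case (3 x y zs)
  then show ?case
    by (simp add: mult_scale_left mult_scale_right scale_right_diff_distrib right_diff_distrib mult_ac)
qed

text \<open>The contraction around \<open>b\<close> carries the factor \<open>\<phi> b = 0\<close>,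
  so nothing couples the units in front of \<open>b\<close> to what follows, and the element
  factorises at \<open>b\<close>.\<close>

lemma wick_ones:
  assumes "\<phi> b = 0"
  shows "wick v Y (replicate m 1 @ b # L) = wick v Y (replicate (Suc m) 1) * (b * wick v Y (1 # L))"
proof -
  have b: "wick v Y (b # L) = b * wick v Y (1 # L)"
    using wick_mult[of v Y b 1 L] by simp
  show ?thesis
    unfolding b[symmetric]
  proof (induction m rule: induct_nat_012)
    case (ge2 m)
    then show ?case by (simp add: left_diff_distrib mult.assoc mult_scale_left)
  qed (simp_all add: assms)
qed

lemma wick_ones_in_algebra: "wick v Y (replicate m 1) \<in> generated_algebra smul {Y}"
proof (induction m rule: induct_nat_012)
  case (ge2 m)
  then show ?case
    by (auto intro!: generated_algebra_diff generated_algebra.mult generated_algebra.smul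
      intro: generated_algebra.base)
qed (auto intro: generated_algebra_zero generated_algebra.one)

text \<open>As \<open>\<phi> 1 = 1\<close>, \<open>wick\<close> on units satisfies the Chebyshev
  recursion, and \<open>Suc m\<close> units give degree \<open>m\<close> in \<open>Y\<close>. The
  recursion multiplies by \<open>Y\<close>; the power \<open>Y ^ n\<close> with arbitrary
  \<open>n\<close> absorbs this.\<close>

lemma wick_ones_chebyshev:
  assumes "has_distribution star \<phi> Y (density lborel (semicircle_density v))" "v > 0"
  shows "\<phi> (Y ^ n * wick v Y (replicate (Suc m) 1)) =
    complex_of_real (\<integral>x. x ^ n * chebyshev v m x \<partial>density lborel (semicircle_density v))"
proof (induction m arbitrary: n rule: induct_nat_012)
  case 0
  then show ?case using assms by (simp add: has_distribution_def)
next
  case 1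
  have "Y ^ n * wick v Y (replicate (Suc 1) 1) = Y ^ Suc n" by (simp add: power_commutes)
  moreover have "x ^ n * chebyshev v 1 x = x ^ Suc n" for x by simp
  ultimately show ?case using assms unfolding has_distribution_def by (simp only: One_nat_def)
next
  case (ge2 m)
  let ?w = "\<lambda>j. wick v Y (replicate j 1)" and ?M = "density lborel (semicircle_density v)"
  have "?w (Suc (Suc (Suc m))) = Y * ?w (Suc (Suc m)) - smul v (?w (Suc m))"
    by (simp add: state_one)
  then have "Y ^ n * ?w (Suc (Suc (Suc m))) = Y ^ Suc n * ?w (Suc (Suc m)) - smul v (Y ^ n * ?w (Suc m))"
    by (simp only: right_diff_distrib mult_scale_right power_Suc2 mult.assoc)
  then have "\<phi> (Y ^ n * ?w (Suc (Suc (Suc m)))) =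
      \<phi> (Y ^ Suc n * ?w (Suc (Suc m))) - v * \<phi> (Y ^ n * ?w (Suc m))"
    by (simp only: state_diff state_scale)
  also have "\<dots> = complex_of_real ((\<integral>x. x ^ Suc n * chebyshev v (Suc m) x \<partial>?M) -
      (\<integral>x. v * (x ^ n * chebyshev v m x) \<partial>?M))"
    unfolding ge2 by simp
  also have "(\<integral>x. x ^ Suc n * chebyshev v (Suc m) x \<partial>?M) - (\<integral>x. v * (x ^ n * chebyshev v m x) \<partial>?M) =
      (\<integral>x. x ^ Suc n * chebyshev v (Suc m) x - v * (x ^ n * chebyshev v m x) \<partial>?M)"
    using assms(2) by (intro Bochner_Integration.integral_diff[symmetric] integrable_mult_right
      semicircle_chebyshev(1))
  also have "(\<lambda>x. x ^ Suc n * chebyshev v (Suc m) x - v * (x ^ n * chebyshev v m x)) =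
      (\<lambda>x. x ^ n * chebyshev v (Suc (Suc m)) x)"
    by (simp add: algebra_simps)
  finally show ?case .
qed

text \<open>Here \<open>m\<close> units give degree \<open>m - 1 > 0\<close>, and Chebyshev
  polynomials of positive degree integrate to zero.\<close>

lemma state_wick_ones:
  assumes "has_distribution star \<phi> Y (density lborel (semicircle_density v))" "v > 0" "m > 1"
  shows "\<phi> (wick v Y (replicate m 1)) = 0"
  using wick_ones_chebyshev[OF assms(1,2), of 0 "m - 1"] semicircle_chebyshev(2)[OF assms(2), of "m - 1"]
    assms(3) by simp

lemma free_prod_list:
  assumes "freely_independent smul \<phi> X Y" "zs \<noteq> []" "distinct_adj (map fst zs)"
    and "\<And>i a. (i, a) \<in> set zs \<Longrightarrow> a \<in> generated_algebra smul {if i then X else Y} \<and> \<phi> a = 0"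
  shows "\<phi> (prod_list (map snd zs)) = 0"
proof -
  have "\<forall>j<length (map snd zs). map snd zs ! j \<in> generated_algebra smul {if map fst zs ! j then X else Y}
      \<and> \<phi> (map snd zs ! j) = 0"
    using assms(4) by (metis length_map nth_map nth_mem prod.collapse)
  moreover have "\<forall>j. Suc j < length (map fst zs) \<longrightarrow> map fst zs ! j \<noteq> map fst zs ! Suc j"
    using assms(3) by (simp only: distinct_adj_conv_nth)
  moreover have "map snd zs \<noteq> []" "length (map fst zs) = length (map snd zs)" "set (map fst zs) \<subseteq> UNIV"
    using assms(2) by simp_all
  ultimately show ?thesis
    using assms(1) unfolding freely_independent_def free_subalgebras_def by blast
qed

text \<open>Each entry is split into a scalar and a centered part. The runs of scalars produce Chebyshev
  polynomials of \<open>Y\<close>, which are centered, so that after expansion only alternating products of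
  centered elements remain; \<open>cs\<close> is the alternating product already split off on the left, and \<open>m\<close>
  the length of the current run.\<close>

lemma state_wick_aux:
  assumes free: "freely_independent smul \<phi> X Y"
    and U: "\<And>m. m > 1 \<Longrightarrow> \<phi> (wick v Y (replicate m 1)) = 0"
  shows "set L \<subseteq> generated_algebra smul {X} \<Longrightarrow> distinct_adj (map fst cs) \<Longrightarrow>
    (\<And>i a. (i, a) \<in> set cs \<Longrightarrow> a \<in> generated_algebra smul {if i then X else Y} \<and> \<phi> a = 0) \<Longrightarrow>
    (cs \<noteq> [] \<Longrightarrow> fst (last cs) \<and> m > 0) \<Longrightarrow> (cs = [] \<Longrightarrow> m + length L > 1) \<Longrightarrow>
    \<phi> (prod_list (map snd cs) * wick v Y (replicate m 1 @ L)) = 0"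
proof (induction L arbitrary: cs m)
  case Nil
  show ?case
  proof (cases "m > 1")
    case True
    let ?zs = "cs @ [(False, wick v Y (replicate m 1))]"
    have "distinct_adj (map fst ?zs)"
      using Nil by (cases "cs = []") (auto simp: distinct_adj_append_iff last_map)
    moreover have "a \<in> generated_algebra smul {if i then X else Y} \<and> \<phi> a = 0"
      if "(i, a) \<in> set ?zs" for i a
      using that Nil(3)[of i a] U[OF True] wick_ones_in_algebra[of v Y m] by auto
    ultimately have "\<phi> (prod_list (map snd ?zs)) = 0"
      by (intro free_prod_list[OF free]) simp_all
    then show ?thesis by simp
  next
    case False
    \<comment> \<open>A single unit gives \<open>wick v Y [1] = 1\<close>, so only the alternating
      product is left.\<close>
    then have "cs \<noteq> []" "m = 1" using Nil by fastforce+
    then show ?thesis using free_prod_list[OF free _ Nil(2,3)] by simp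
  qed
next
  case (Cons a L)
  let ?c = "prod_list (map snd cs)"
  define b where "b = a - smul (\<phi> a) 1"
  have b: "b \<in> generated_algebra smul {X}" "\<phi> b = 0"
    using Cons.prems(1) unfolding b_def
    by (auto intro!: generated_algebra_diff generated_algebra.smul generated_algebra.one
      simp: state_diff state_scale state_one)
  have a: "a = b + smul (\<phi> a) 1" by (simp add: b_def)
  \<comment> \<open>Scalar part of \<open>a\<close>: the unit joins the current run.\<close>
  have "\<phi> (?c * wick v Y (replicate (Suc m) 1 @ L)) = 0"
    using Cons.prems by (intro Cons.IH) auto
  moreover have "replicate (Suc m) 1 @ L = replicate m 1 @ 1 # L"
    by (simp add: replicate_app_Cons_same)
  ultimately have scalar: "\<phi> (?c * wick v Y (replicate m 1 @ 1 # L)) = 0" by (simp only:)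
  \<comment> \<open>Centered part of \<open>a\<close>: the run closes as a factor of degree
    \<open>m\<close> in \<open>Y\<close>, followed by \<open>b\<close>, and a new run of one unit
    starts. For \<open>m = 0\<close> there is no such factor, but then \<open>cs\<close> is empty
    and the product still alternates.\<close>
  let ?cs = "cs @ (if m > 0 then [(False, wick v Y (replicate (Suc m) 1))] else []) @ [(True, b)]"
  have "\<phi> (prod_list (map snd ?cs) * wick v Y (replicate 1 1 @ L)) = 0"
  proof (rule Cons.IH)
    show "distinct_adj (map fst ?cs)"
      using Cons.prems(2,4) by (cases "cs = []") (auto simp: distinct_adj_append_iff last_map)
    show "a \<in> generated_algebra smul {if i then X else Y} \<and> \<phi> a = 0" if "(i, a) \<in> set ?cs" for i a
      using that Cons.prems(3)[of i a] b U[of "Suc m"] wick_ones_in_algebra[of v Y "Suc m"]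
      by (auto split: if_splits)
  qed (use Cons.prems in auto)
  moreover have "prod_list (map snd ?cs) * wick v Y (replicate 1 1 @ L) =
      ?c * wick v Y (replicate m 1 @ b # L)"
    unfolding wick_ones[OF b(2)] by (simp add: mult.assoc)
  ultimately have centered: "\<phi> (?c * wick v Y (replicate m 1 @ b # L)) = 0" by simp
  have "wick v Y (replicate m 1 @ a # L) =
      wick v Y (replicate m 1 @ b # L) + smul (\<phi> a) (wick v Y (replicate m 1 @ 1 # L))"
    by (subst a) (simp only: wick_add wick_scale)
  then show ?case
    using scalar centered by (simp add: distrib_left state_add mult_scale_right state_scale)
qed

lemma state_wick:
  assumes "freely_independent smul \<phi> X Y" "\<And>m. m > 1 \<Longrightarrow> \<phi> (wick v Y (replicate m 1)) = 0"
    and "set L \<subseteq> generated_algebra smul {X}" "length L > 1"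
  shows "\<phi> (wick v Y L) = 0"
  using state_wick_aux[OF assms(1-3), of "[]" 0] assms(4) by simp

text \<open>The conditional expectation of \<open>(X + Y) ^ k\<close> onto the algebra generated by \<open>X\<close>.\<close>

fun cond_power :: "complex \<Rightarrow> 'a \<Rightarrow> nat \<Rightarrow> 'a" where
  "cond_power v X 0 = 1"
| "cond_power v X (Suc k) = X * cond_power v X k +
     (\<Sum>i<k. smul (v * \<phi> (cond_power v X i)) (cond_power v X (k - Suc i)))"

lemma cond_power_in_algebra: "cond_power v X k \<in> generated_algebra smul {X}"
proof (induction k rule: less_induct)
  case (less k)
  show ?case
  proof (cases k)
    case 0
    then show ?thesis by (simp add: generated_algebra.one)
  next
    case (Suc n)
    then show ?thesis
      using less by (auto intro!: generated_algebra.add generated_algebra.mult generated_algebra_sum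
        generated_algebra.smul intro: generated_algebra.base)
  qed
qed

end

text \<open>Compositions of \<open>n\<close> with every part lowered by one.\<close>

definition weak_compositions :: "nat \<Rightarrow> nat list set" where
  "weak_compositions n = {js. sum_list js + length js = n}"

lemma weak_compositions_0: "weak_compositions 0 = {[]}"
  by (auto simp: weak_compositions_def)

lemma weak_compositions_Suc:
  "weak_compositions (Suc n) = (\<lambda>(i, js). i # js) ` (SIGMA i:{..n}. weak_compositions (n - i))"
proof (intro equalityI subsetI)
  fix js assume "js \<in> weak_compositions (Suc n)"
  then show "js \<in> (\<lambda>(i, js). i # js) ` (SIGMA i:{..n}. weak_compositions (n - i))"
    by (cases js) (auto simp: weak_compositions_def image_iff)
qed (auto simp: weak_compositions_def)

lemma finite_weak_compositions: "finite (weak_compositions n)"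
proof (induction n rule: less_induct)
  case (less n)
  then show ?case
    by (cases n) (auto simp: weak_compositions_0 weak_compositions_Suc intro!: finite_imageI finite_SigmaI)
qed

lemma sum_weak_compositions_Suc:
  "sum f (weak_compositions (Suc n)) = (\<Sum>i\<le>n. \<Sum>js\<in>weak_compositions (n - i). f (i # js))"
proof -
  have "inj_on (\<lambda>(i, js). i # js) (SIGMA i:{..n}. weak_compositions (n - i))"
    by (auto simp: inj_on_def)
  then show ?thesis
    unfolding weak_compositions_Suc
    by (simp add: sum.reindex sum.Sigma finite_weak_compositions case_prod_unfold)
qed

context star_prob_space
begin

section \<open>Expansion of powers of \<open>X + Y\<close> into Wick elements\<close>

lemma wick_sum:
  "wick v Y ((\<Sum>i\<in>A. smul (c i) (f i)) # L) = (\<Sum>i\<in>A. smul (c i) (wick v Y (f i # L)))"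
proof (induction A rule: infinite_finite_induct)
  case (insert x A)
  then show ?case
    using wick_add[of v Y "[]" "smul (c x) (f x)"] wick_scale[of v Y "[]"] by simp
\<comment> \<open>Both factors zero gives \<open>wick v Y (0 # L) = 0\<close>, the value for the
  empty sum.\<close>
qed (use wick_mult[of v Y 0 0 L] in simp_all)

text \<open>Induction by left multiplication. \<open>X\<close> raises the first index, up to the
  correction terms of \<open>cond_power\<close>; \<open>Y\<close> puts a new entry
  \<open>cond_power v X 0 = 1\<close> in front and contracts the old first entry. Corrections and
  contractions cancel.\<close>

lemma power_add_eq_sum_wick:
  "(X + Y) ^ k = (\<Sum>js\<in>weak_compositions (Suc k). wick v Y (map (cond_power v X) js))"
proof (induction k)
  case 0
  show ?case by (simp add: sum_weak_compositions_Suc weak_compositions_0)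
next
  case (Suc k)
  let ?E = "cond_power v X"
  let ?W = "\<lambda>js. wick v Y (map ?E js)"
  let ?C = weak_compositions
  \<comment> \<open>The terms in which index \<open>l\<close> has been absorbed into a scalar and
    \<open>j\<close> is the new first index; multiplication by \<open>X\<close> and by
    \<open>Y\<close> both produce them.\<close>
  define g where "g l j = (\<Sum>js\<in>?C (k - Suc (l + j)). smul (v * \<phi> (?E l)) (?W (j # js)))" for l j
  have X: "(\<Sum>i\<le>k. \<Sum>js\<in>?C (k - i). ?W (Suc i # js)) =
      (\<Sum>js\<in>?C (Suc k). X * ?W js) + (\<Sum>i\<le>k. \<Sum>l<i. g l (i - Suc l))"
  proof -
    have "?W (Suc i # js) = X * ?W (i # js) +
        (\<Sum>l<i. smul (v * \<phi> (?E l)) (?W ((i - Suc l) # js)))" for i js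
      using wick_add[of v Y "[]" "X * ?E i"] by (simp add: wick_mult wick_sum)
    moreover have "(\<Sum>js\<in>?C (k - i). \<Sum>l<i. smul (v * \<phi> (?E l)) (?W ((i - Suc l) # js))) =
        (\<Sum>l<i. g l (i - Suc l))" for i
      unfolding g_def by (subst sum.swap) (auto intro!: sum.cong)
    ultimately show ?thesis by (simp add: sum.distrib sum_weak_compositions_Suc)
  qed
  have inner: "(\<Sum>js\<in>?C (k - i). smul (v * \<phi> (?E i)) (?W js)) = (\<Sum>j<k - i. g i j)" for i
  proof (cases "k - i")
    case 0
    then show ?thesis by (simp add: weak_compositions_0)
  next
    case (Suc n)
    then have "n = k - Suc i" by simp
    then show ?thesis
      by (simp add: Suc sum_weak_compositions_Suc g_def lessThan_Suc_atMost flip: map_map)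
  qed
  \<comment> \<open>The recursion of \<open>wick\<close> with leading entry \<open>1\<close>, solved
    for the contraction term.\<close>
  have contract: "smul (v * \<phi> (?E i)) (?W js) = Y * ?W (i # js) - wick v Y (1 # map ?E (i # js))" for i js
    by simp
  have "(\<Sum>i\<le>k. \<Sum>j<k - i. g i j) =
      (\<Sum>js\<in>?C (Suc k). Y * ?W js - wick v Y (1 # map ?E js))"
    unfolding inner[symmetric] contract sum_weak_compositions_Suc ..
  also have "\<dots> = (\<Sum>js\<in>?C (Suc k). Y * ?W js) - (\<Sum>js\<in>?C (Suc k). wick v Y (1 # map ?E js))"
    by (rule sum_subtractf)
  finally have "(\<Sum>i\<le>k. \<Sum>j<k - i. g i j) =
      (\<Sum>js\<in>?C (Suc k). Y * ?W js) - (\<Sum>js\<in>?C (Suc k). wick v Y (1 # map ?E js))" .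
  \<comment> \<open>Both sides run over all \<open>l\<close>, \<open>j\<close> with
    \<open>l + j < k\<close>; on the right the outer index is \<open>l + j + 1\<close>.\<close>
  moreover have "(\<Sum>i\<le>k. \<Sum>j<k - i. g i j) = (\<Sum>i\<le>k. \<Sum>l<i. g l (i - Suc l))"
    unfolding sum.Sigma[OF finite_atMost ballI[OF finite_lessThan]]
    by (rule sum.reindex_bij_witness[of _ "\<lambda>(i, l). (l, i - Suc l)" "\<lambda>(i, j). (Suc (i + j), i)"]) auto
  ultimately have Y: "(\<Sum>js\<in>?C (Suc k). Y * ?W js) =
      (\<Sum>js\<in>?C (Suc k). wick v Y (1 # map ?E js)) + (\<Sum>i\<le>k. \<Sum>l<i. g l (i - Suc l))"
    by simp
  have "(\<Sum>js\<in>?C (Suc (Suc k)). ?W js) =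
      (\<Sum>js\<in>?C (Suc k). wick v Y (1 # map ?E js)) + (\<Sum>i\<le>k. \<Sum>js\<in>?C (k - i). ?W (Suc i # js))"
    unfolding sum_weak_compositions_Suc[of _ "Suc k"] sum.atMost_Suc_shift
    by (simp del: cond_power.simps(2) wick.simps)
  also have "\<dots> = (\<Sum>js\<in>?C (Suc k). X * ?W js) + (\<Sum>js\<in>?C (Suc k). Y * ?W js)"
    unfolding X Y by simp
  also have "\<dots> = (X + Y) ^ Suc k"
    by (simp add: Suc distrib_right sum_distrib_left sum.distrib)
  finally show ?case ..
qed

text \<open>Only the composition \<open>[k]\<close> has length one; every other Wick element has at
  least two entries and hence state zero.\<close>

lemma state_power_add:
  assumes free: "freely_independent smul \<phi> X Y"
    and Y: "has_distribution star \<phi> Y (density lborel (semicircle_density v))" "v > 0"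
  shows "\<phi> ((X + Y) ^ k) = \<phi> (cond_power v X k)"
proof -
  let ?W = "\<lambda>js. \<phi> (wick v Y (map (cond_power v X) js))"
  have mem: "[k] \<in> weak_compositions (Suc k)" by (simp add: weak_compositions_def)
  have "?W js = 0" if "js \<in> weak_compositions (Suc k) - {[k]}" for js
  proof (rule state_wick[OF free state_wick_ones[OF Y]])
    show "set (map (cond_power v X) js) \<subseteq> generated_algebra smul {X}"
      by (auto simp: cond_power_in_algebra)
    have "js \<noteq> []" "js \<noteq> [i]" for i using that by (auto simp: weak_compositions_def)
    then show "length (map (cond_power v X) js) > 1"
      by (metis length_0_conv length_Suc_conv length_map less_one linorder_neqE_nat One_nat_def)
  qed
  then have "(\<Sum>js\<in>weak_compositions (Suc k). ?W js) = ?W [k]"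
    by (subst sum.remove[OF finite_weak_compositions mem]) simp
  then show ?thesis by (simp add: power_add_eq_sum_wick[of X Y k v] state_sum)
qed

end

section \<open>Assembly of the moment formula\<close>

lemma isolated_sum_pairings:
  "isolated_sum t {1..n} {1..n} = (\<Sum>\<pi>\<in>pairings n. t ^ card (isolated_chords \<pi>))"
  unfolding isolated_sum_def pairings_eq
proof (rule sum.cong[OF refl])
  fix \<pi> assume "\<pi> \<in> pairings_on {1..n}"
  then have "{C \<in> isolated_chords \<pi>. C \<subseteq> {1..n}} = isolated_chords \<pi>"
    using pairings_onD(4) by (fastforce simp: isolated_chords_def)
  then show "t ^ card {C \<in> isolated_chords \<pi>. C \<subseteq> {1..n}} = t ^ card (isolated_chords \<pi>)"
    by simp
qed

lemma (in star_prob_space) free_convolution_moment: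
  fixes \<sigma> s :: real
  assumes \<sigma>: "\<sigma> > 0" and s: "s > 0"
    and free: "freely_independent smul \<phi> X Y"
    and X: "has_distribution star \<phi> X (density lborel (normal_density 0 \<sigma>))"
    and Y: "has_distribution star \<phi> Y (density lborel (semicircle_density (s * \<sigma>\<^sup>2)))"
  shows "\<phi> ((X + Y) ^ k) =
    complex_of_real (\<sigma> ^ k * (\<Sum>\<pi>\<in>pairings k. (s + 1) ^ card (isolated_chords \<pi>)))"
proof -
  define v where "v = complex_of_real (s * \<sigma>\<^sup>2)"
  define F where "F n k = \<phi> (X ^ n * cond_power v X k)" for n k
  have F_0: "F (card A) 0 = complex_of_real \<sigma> ^ card A * of_nat (card (pairings_on A))"
    if "finite A" for A :: "nat set"
    using X normal_moment[OF \<sigma> that] by (simp add: F_def has_distribution_def)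
  have F_Suc: "F n (Suc k) = F (Suc n) k + of_real s * (of_real \<sigma>)\<^sup>2 * (\<Sum>i<k. F 0 i * F n (k - Suc i))" for n k
  proof -
    have "X ^ n * cond_power v X (Suc k) = X ^ Suc n * cond_power v X k +
        (\<Sum>i<k. smul (v * \<phi> (cond_power v X i)) (X ^ n * cond_power v X (k - Suc i)))"
      unfolding cond_power.simps distrib_left sum_distrib_left mult_scale_right power_Suc2 mult.assoc ..
    then show ?thesis
      by (simp add: F_def state_add state_sum state_scale sum_distrib_left v_def mult.assoc
        del: cond_power.simps)
  qed
  have "\<phi> ((X + Y) ^ k) = F 0 k"
    using state_power_add[OF free Y] \<sigma> s by (simp add: F_def v_def)
  \<comment> \<open>With \<open>K = A\<close> no point precedes \<open>K\<close>, so the first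
    argument of \<open>F\<close> is \<open>0\<close>.\<close>
  also have "\<dots> = of_real \<sigma> ^ k * isolated_sum (of_real s + 1) {1..k} {1..k}"
    using isolated_sum_unique[OF F_0 F_Suc, of "{1..k}" "{1..k}"] by simp
  finally show ?thesis unfolding isolated_sum_pairings by simp
qed

theorem theorem3p1:
  fixes \<sigma> s :: real and \<mu>GS :: "real measure" and m :: "nat \<Rightarrow> real"
  assumes "\<sigma> > 0" and "s > 0"
    and "is_free_convolution TYPE('a::ring_1)
           (density lborel (normal_density 0 \<sigma>))
           (density lborel (semicircle_density (s * \<sigma>\<^sup>2)))
           \<mu>GS"
    and "\<And>k. k > 0 \<Longrightarrow> m k = (\<integral>x. x ^ k \<partial>\<mu>GS)"
  shows "\<forall>k>0. \<forall>r. (k = 2 * r + 1 \<longrightarrow> m k = 0) \<and>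
           (k = 2 * r \<longrightarrow>
              m k = \<sigma> ^ (2 * r) * (\<Sum>\<pi>\<in>pairings (2 * r). (s + 1) ^ card (isolated_chords \<pi>)))"
proof (intro allI impI)
  fix k r :: nat
  assume "k > 0"
  obtain smul :: "complex \<Rightarrow> 'a \<Rightarrow> 'a" and star \<phi> X Y
    where sps: "star_prob_space smul star \<phi>" and free: "freely_independent smul \<phi> X Y"
      and X: "has_distribution star \<phi> X (density lborel (normal_density 0 \<sigma>))"
      and Y: "has_distribution star \<phi> Y (density lborel (semicircle_density (s * \<sigma>\<^sup>2)))"
      and XY: "has_distribution star \<phi> (X + Y) \<mu>GS"
    using assms(3) unfolding is_free_convolution_def by blast
  interpret star_prob_space smul star \<phi> by (rule sps)
  have "complex_of_real (m k) = \<phi> ((X + Y) ^ k)"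
    using XY assms(4)[OF \<open>k > 0\<close>] by (simp add: has_distribution_def)
  then have m: "m k = \<sigma> ^ k * (\<Sum>\<pi>\<in>pairings k. (s + 1) ^ card (isolated_chords \<pi>))"
    unfolding free_convolution_moment[OF assms(1,2) free X Y] of_real_eq_iff .
  \<comment> \<open>An empty sum: the one formula \<open>m\<close> thus also yields the odd
    case.\<close>
  have "pairings k = {}" if "k = 2 * r + 1"
    using that by (simp add: pairings_eq pairings_on_odd)
  then show "(k = 2 * r + 1 \<longrightarrow> m k = 0) \<and>
      (k = 2 * r \<longrightarrow>
        m k = \<sigma> ^ (2 * r) * (\<Sum>\<pi>\<in>pairings (2 * r). (s + 1) ^ card (isolated_chords \<pi>)))"
    using m by auto
qed

end
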